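(* Let $(X,\mu)$ be a standard probability space, let $T$ be a measure-preserving automorphism of $(X,\mu)$, and let $f \in L^1(X,\mu)$ be real-valued. For $n \ge 1$ and $x \in X$ put \[ A_f[T,n](x) := \frac{1}{n}\sum_{i=0}^{n-1} f(T^i x). \] Then for $\mu$-a.e. $x \in X$ the limit $\lim_{n\to\infty} A_f[T,n](x)$ exists, and it is equal ($\mu$-a.e.) to the conditional expectation of $f$ with respect to the $\sigma$-algebra of $T$-invariant measurable sets.
   Context: A standard probability space is a standard Borel space $X$ equipped with a Borel probability measure $\mu$. An automorphism $T$ of $(X,\mu)$ is a Borel bijection $T : X \to X$ (with Borel inverse) preserving $\mu$, i.e. $\mu(T^{-1}A) = \mu(A)$ for all measurable $A$. A measurable set $A \subseteq X$ is $T$-invariant if $T^{-1}A = A$. Neither ergodicity nor aperiodicity of $T$ is assumed. *)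

theory Defs
  imports "HOL-Probability.Probability"
begin

text \<open>
  The Polish topology lives on the carrier \<^term>\<open>space M\<close>, not on the whole type, so it is an
  abstract topology rather than an instance of \<^class>\<open>polish_space\<close>. The last conjunct says that
  the measurable sets are exactly the Borel sets of that topology.
\<close>

definition standard_borel :: "'a measure \<Rightarrow> bool" where
  "standard_borel M \<longleftrightarrow>
     (\<exists>X. completely_metrizable_space X \<and> separable_space X \<and> topspace X = space M \<and>
          sets M = sigma_sets (space M) {U. openin X U})"

definition standard_prob_space :: "'a measure \<Rightarrow> bool" where
  "standard_prob_space M \<longleftrightarrow> standard_borel M \<and> prob_space M"

definition mp_automorphism :: "'a measure \<Rightarrow> ('a \<Rightarrow> 'a) \<Rightarrow> bool" where
  "mp_automorphism M T \<longleftrightarrow>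
     bij_betw T (space M) (space M) \<and>
     T \<in> measurable M M \<and>
     inv_into (space M) T \<in> measurable M M \<and>
     (\<forall>A\<in>sets M. emeasure M (T -` A \<inter> space M) = emeasure M A)"

definition invariant_algebra :: "'a measure \<Rightarrow> ('a \<Rightarrow> 'a) \<Rightarrow> 'a measure" where
  "invariant_algebra M T = sigma (space M) {A \<in> sets M. T -` A \<inter> space M = A}"

text \<open>
  The invariant measurable sets already form a \<open>\<sigma>\<close>-algebra, so taking the generated one adds nothing.
\<close>

lemma space_invariant_algebra [simp]: "space (invariant_algebra M T) = space M"
  unfolding invariant_algebra_def by (simp add: space_measure_of_conv)

lemma sets_invariant_algebra:
  assumes T: "T \<in> measurable M M"
  shows "sets (invariant_algebra M T) = {A \<in> sets M. T -` A \<inter> space M = A}"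
proof -
  let ?I = "{A \<in> sets M. T -` A \<inter> space M = A}"
  have sub: "?I \<subseteq> Pow (space M)"
    using sets.sets_into_space by blast
  have "sigma_algebra (space M) ?I"
    unfolding sigma_algebra_iff2
  proof (intro conjI ballI allI impI)
    show "?I \<subseteq> Pow (space M)" by (rule sub)
    show "{} \<in> ?I" by simp
    show "space M - A \<in> ?I" if "A \<in> ?I" for A
      using that measurable_space[OF T] by auto
    show "(\<Union>i. A i) \<in> ?I" if "range A \<subseteq> ?I" for A :: "nat \<Rightarrow> 'a set"
    proof -
      have "A i \<in> sets M" "T -` A i \<inter> space M = A i" for i
        using that by auto
      moreover have "T -` (\<Union>i. A i) \<inter> space M = (\<Union>i. T -` A i \<inter> space M)"
        by blast
      ultimately show ?thesis by auto
    qed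
  qed
  then show ?thesis
    unfolding invariant_algebra_def
    using sub by (simp add: sigma_algebra.sigma_sets_eq)
qed

lemma subalgebra_invariant_algebra:
  assumes "T \<in> measurable M M"
  shows "subalgebra M (invariant_algebra M T)"
  using sets_invariant_algebra[OF assms] by (auto simp: subalgebra_def)

definition ergodic_average :: "('a \<Rightarrow> 'a) \<Rightarrow> ('a \<Rightarrow> real) \<Rightarrow> nat \<Rightarrow> 'a \<Rightarrow> real" where
  "ergodic_average T f n x = (1 / real n) * (\<Sum>i<n. f ((T ^^ i) x))"

end

theory Submission
  imports Defs
begin

text \<open>
  This is Birkhoff's pointwise ergodic theorem. Write \<open>h\<close> for the conditional expectation of \<open>f\<close> on
  the invariant sets and \<open>S\<^sub>n g\<close> for the sum of \<open>g\<close> along the first \<open>n\<close> points of an orbit. Since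
  \<open>h\<close> is constant along orbits, it suffices that for each \<open>\<epsilon> > 0\<close> the sums of
  \<open>g = f - h - \<epsilon>\<close> and of \<open>g = h - f - \<epsilon>\<close> are almost everywhere bounded above: dividing by \<open>n\<close>, the
  averages of \<open>f\<close> are then eventually within \<open>2\<epsilon>\<close> of \<open>h\<close>. Both functions have integral
  \<open>-\<epsilon> \<mu>(A)\<close> over each invariant set \<open>A\<close>.

  The boundedness is a maximal inequality (\<open>integral_unbounded_set_nonneg\<close>). The running maximum
  \<open>W\<^sub>n\<close> of \<open>S\<^sub>1 g, \<dots>, S\<^bsub>n+1\<^esub> g\<close> increases with \<open>n\<close> and satisfies
  \<open>W\<^bsub>n+1\<^esub> - W\<^sub>n \<circ> T = g - min 0 (W\<^sub>n \<circ> T)\<close>. The set \<open>A\<close> where \<open>W\<^sub>n\<close> is unbounded is invariant, so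
  over \<open>A\<close> the left side has the same integral as \<open>W\<^bsub>n+1\<^esub> - W\<^sub>n \<ge> 0\<close>, whereas the right side tends to
  \<open>g\<close> on \<open>A\<close>, dominated by \<open>\<bar>g\<bar> + \<bar>g \<circ> T\<bar>\<close>. Hence \<open>g\<close> has nonnegative integral over \<open>A\<close>; if that
  integral is \<open>-\<epsilon> \<mu>(A)\<close>, then \<open>A\<close> is null.
\<close>

section \<open>Invariant sets and functions\<close>

locale finite_measure_preserving = finite_measure M for M :: "'a measure" +
  fixes T :: "'a \<Rightarrow> 'a"
  assumes T_measurable [measurable]: "T \<in> measurable M M"
    and emeasure_vimage: "A \<in> sets M \<Longrightarrow> emeasure M (T -` A \<inter> space M) = emeasure M A"
begin

lemma distr_eq: "distr M M T = M"
  by (rule measure_eqI) (auto simp: emeasure_distr emeasure_vimage)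

lemma integrable_comp:
  fixes f :: "'a \<Rightarrow> real"
  assumes "integrable M f"
  shows "integrable M (\<lambda>x. f (T x))"
  using integrable_distr[of T M M f] assms by (simp add: distr_eq)

lemma integral_comp:
  fixes f :: "'a \<Rightarrow> real"
  assumes [measurable]: "f \<in> borel_measurable M"
  shows "(\<integral>x. f (T x) \<partial>M) = (\<integral>x. f x \<partial>M)"
  using integral_distr[of T M M f] by (simp add: distr_eq)

lemma invariant_iff:
  assumes "A \<in> sets (invariant_algebra M T)" "x \<in> space M"
  shows "T x \<in> A \<longleftrightarrow> x \<in> A"
  using assms sets_invariant_algebra[OF T_measurable] by blast

text \<open>The level set of \<open>h\<close> through \<open>x\<close> is an invariant set, so it contains \<open>T x\<close> as well.\<close>

lemma invariant_measurable_comp: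
  fixes h :: "'a \<Rightarrow> real"
  assumes h: "h \<in> borel_measurable (invariant_algebra M T)" and x: "x \<in> space M"
  shows "h (T x) = h x"
proof -
  have "h -` {h x} \<inter> space M \<in> sets (invariant_algebra M T)"
    using measurable_sets[OF h, of "{h x}"] by simp
  from invariant_iff[OF this x] x show ?thesis by auto
qed

lemma iterate_in_space: "x \<in> space M \<Longrightarrow> (T ^^ i) x \<in> space M"
  by (induction i) (auto intro: measurable_space[OF T_measurable])

lemma invariant_measurable_iterate:
  fixes h :: "'a \<Rightarrow> real"
  assumes "h \<in> borel_measurable (invariant_algebra M T)" "x \<in> space M"
  shows "h ((T ^^ i) x) = h x"
  using assms by (induction i) (auto simp: invariant_measurable_comp iterate_in_space)

section \<open>The maximal inequality\<close>

text \<open>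
  The maximum of the orbit sums of lengths \<open>1\<close> to \<open>n + 1\<close>. The recursion peels off the first point of
  the orbit, which makes the relation to \<open>W\<^sub>n \<circ> T\<close> definitional.
\<close>

primrec max_orbit_sum :: "('a \<Rightarrow> real) \<Rightarrow> nat \<Rightarrow> 'a \<Rightarrow> real" where
  "max_orbit_sum g 0 x = g x"
| "max_orbit_sum g (Suc n) x = g x + max 0 (max_orbit_sum g n (T x))"

lemma max_orbit_sum_mono_Suc: "max_orbit_sum g n x \<le> max_orbit_sum g (Suc n) x"
proof (induction n arbitrary: x)
  case (Suc n)
  from Suc[of "T x"] show ?case by (auto simp: max_def)
qed simp

lemma max_orbit_sum_mono: "m \<le> n \<Longrightarrow> max_orbit_sum g m x \<le> max_orbit_sum g n x"
  by (rule lift_Suc_mono_le[of "\<lambda>n. max_orbit_sum g n x"]) (rule max_orbit_sum_mono_Suc)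

lemma orbit_sum_le_max_orbit_sum: "(\<Sum>i<Suc n. g ((T ^^ i) x)) \<le> max_orbit_sum g n x"
proof (induction n arbitrary: x)
  case (Suc n)
  have "(\<Sum>i<Suc (Suc n). g ((T ^^ i) x)) = g x + (\<Sum>i<Suc n. g ((T ^^ i) (T x)))"
    by (subst sum.lessThan_Suc_shift) (simp add: funpow_swap1)
  with Suc[of "T x"] show ?case by auto
qed simp

lemma integrable_max_orbit_sum:
  assumes "integrable M g"
  shows "integrable M (max_orbit_sum g n)"
proof (induction n)
  case 0
  then show ?case using assms by (simp add: max_orbit_sum.simps(1)[abs_def])
next
  case (Suc n)
  then show ?case
    using assms integrable_comp[OF Suc] by (simp add: max_orbit_sum.simps(2)[abs_def])
qed

definition unbounded_set :: "('a \<Rightarrow> real) \<Rightarrow> 'a set" where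
  "unbounded_set g = {x \<in> space M. \<forall>N::nat. \<exists>n. max_orbit_sum g n x > real N}"

lemma unbounded_set_invariant:
  assumes "integrable M g"
  shows "unbounded_set g \<in> sets (invariant_algebra M T)"
proof -
  have [measurable]: "max_orbit_sum g n \<in> borel_measurable M" for n
    using integrable_max_orbit_sum[OF assms] by auto
  have "unbounded_set g \<in> sets M"
    unfolding unbounded_set_def by measurable
  moreover have "T x \<in> unbounded_set g \<longleftrightarrow> x \<in> unbounded_set g" if x: "x \<in> space M" for x
  proof
    assume *: "T x \<in> unbounded_set g"
    have "\<exists>n. max_orbit_sum g n x > real N" for N :: nat
    proof -
      obtain K :: nat where K: "real N - g x < real K" using reals_Archimedean2 by blast
      obtain n where "max_orbit_sum g n (T x) > real K"
        using * unfolding unbounded_set_def by blast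
      then have "max_orbit_sum g (Suc n) x > real N" using K by simp
      then show ?thesis by blast
    qed
    then show "x \<in> unbounded_set g" using x by (simp add: unbounded_set_def)
  next
    assume *: "x \<in> unbounded_set g"
    have "\<exists>n. max_orbit_sum g n (T x) > real N" for N :: nat
    proof -
      obtain K :: nat where K: "real N + g x < real K" using reals_Archimedean2 by blast
      obtain n where "max_orbit_sum g n x > real K"
        using * unfolding unbounded_set_def by blast
      then have "max_orbit_sum g (Suc n) x > real K"
        using max_orbit_sum_mono_Suc[of g n x] by linarith
      then have "max 0 (max_orbit_sum g n (T x)) > real N" using K by simp
      then show ?thesis by (auto simp: max_def split: if_splits)
    qed
    then show "T x \<in> unbounded_set g"
      using x measurable_space[OF T_measurable] by (simp add: unbounded_set_def)
  qed
  ultimately show ?thesis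
    using sets.sets_into_space by (auto simp: sets_invariant_algebra unbounded_set_def)
qed

text \<open>
  The maximal inequality. Invariance of the set is what lets \<open>W\<^sub>n\<close> be replaced by \<open>W\<^sub>n \<circ> T\<close> under the
  integral.
\<close>

lemma integral_unbounded_set_nonneg:
  assumes g: "integrable M g"
  shows "0 \<le> (\<integral>x. indicator (unbounded_set g) x * g x \<partial>M)"
proof -
  define A where "A = unbounded_set g"
  define W where "W = max_orbit_sum g"
  define D where "D n x = indicator A x * (g x - min 0 (W n (T x)))" for n x
  have A: "A \<in> sets (invariant_algebra M T)"
    unfolding A_def by (rule unbounded_set_invariant[OF g])
  then have A_meas [measurable]: "A \<in> sets M"
    by (simp add: sets_invariant_algebra)
  have W_int: "integrable M (W n)" for n
    unfolding W_def by (rule integrable_max_orbit_sum[OF g])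
  have [measurable]: "W n \<in> borel_measurable M" "g \<in> borel_measurable M" for n
    using W_int g by auto
  have intA: "integrable M (\<lambda>x. indicator A x * u x)" if "integrable M u" for u :: "'a \<Rightarrow> real"
    using integrable_mult_indicator[OF A_meas that] by simp
  have nonneg: "0 \<le> (\<integral>x. D n x \<partial>M)" for n
  proof -
    have "(\<integral>x. D n x \<partial>M) = (\<integral>x. indicator A x * W (Suc n) x - indicator A (T x) * W n (T x) \<partial>M)"
      by (rule Bochner_Integration.integral_cong)
         (auto simp: D_def W_def indicator_def invariant_iff[OF A] max_def min_def)
    also have "\<dots> = (\<integral>x. indicator A x * W (Suc n) x \<partial>M) - (\<integral>x. indicator A (T x) * W n (T x) \<partial>M)"
      using integrable_comp[OF intA[OF W_int[of n]]] intA[OF W_int[of "Suc n"]]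
      by (intro Bochner_Integration.integral_diff)
    also have "(\<integral>x. indicator A (T x) * W n (T x) \<partial>M) = (\<integral>x. indicator A x * W n x \<partial>M)"
      by (rule integral_comp) measurable
    finally have "(\<integral>x. D n x \<partial>M)
        = (\<integral>x. indicator A x * W (Suc n) x \<partial>M) - (\<integral>x. indicator A x * W n x \<partial>M)" .
    moreover have "(\<integral>x. indicator A x * W n x \<partial>M) \<le> (\<integral>x. indicator A x * W (Suc n) x \<partial>M)"
      using max_orbit_sum_mono_Suc[of g n]
      by (intro integral_mono intA W_int) (auto simp: W_def indicator_def simp del: max_orbit_sum.simps)
    ultimately show ?thesis by linarith
  qed
  have "(\<lambda>n. \<integral>x. D n x \<partial>M) \<longlonglongrightarrow> (\<integral>x. indicator A x * g x \<partial>M)"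
  proof (rule integral_dominated_convergence)
    show "integrable M (\<lambda>x. \<bar>g x\<bar> + \<bar>g (T x)\<bar>)"
      using g integrable_comp[OF g] by simp
    show "AE x in M. norm (D n x) \<le> \<bar>g x\<bar> + \<bar>g (T x)\<bar>" for n
    proof (rule AE_I2)
      fix x
      have "g (T x) \<le> W n (T x)"
        using max_orbit_sum_mono[of 0 n g "T x"] by (simp add: W_def)
      then show "norm (D n x) \<le> \<bar>g x\<bar> + \<bar>g (T x)\<bar>"
        by (auto simp: D_def indicator_def min_def)
    qed
    show "AE x in M. (\<lambda>n. D n x) \<longlonglongrightarrow> indicator A x * g x"
    proof (rule AE_I2)
      fix x assume x: "x \<in> space M"
      show "(\<lambda>n. D n x) \<longlonglongrightarrow> indicator A x * g x"
      proof (cases "x \<in> A")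
        case True
        then have "T x \<in> A" using invariant_iff[OF A x] by simp
        then obtain m where "W m (T x) > real 0"
          unfolding A_def unbounded_set_def W_def by blast
        then have "W n (T x) > 0" if "m \<le> n" for n
          using max_orbit_sum_mono[OF that, of g "T x"] by (simp add: W_def)
        then have "eventually (\<lambda>n. D n x = indicator A x * g x) sequentially"
          by (intro eventually_sequentiallyI[of m]) (fastforce simp: D_def min_def)
        then show ?thesis by (rule tendsto_eventually)
      qed (simp add: D_def)
    qed
  qed (simp_all add: D_def)
  then show ?thesis
    using nonneg unfolding A_def by (intro LIMSEQ_le_const) auto
qed

lemma AE_orbit_sums_bounded_above:
  assumes g: "integrable M g" and "\<epsilon> > 0"
    and int: "\<And>A. A \<in> sets (invariant_algebra M T) \<Longrightarrow>
      (\<integral>x. indicator A x * g x \<partial>M) = - \<epsilon> * measure M A"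
  shows "AE x in M. \<exists>N::nat. \<forall>n. (\<Sum>i<n. g ((T ^^ i) x)) \<le> real N"
proof -
  let ?A = "unbounded_set g"
  have A: "?A \<in> sets (invariant_algebra M T)" by (rule unbounded_set_invariant[OF g])
  have "0 \<le> - \<epsilon> * measure M ?A"
    using integral_unbounded_set_nonneg[OF g] int[OF A] by simp
  then have "measure M ?A = 0"
    using \<open>\<epsilon> > 0\<close> measure_nonneg[of M ?A] by (simp add: mult_le_0_iff)
  then have "?A \<in> null_sets M"
    using A by (auto simp: sets_invariant_algebra emeasure_eq_measure null_sets_def)
  then have "AE x in M. x \<notin> ?A" by (rule AE_not_in)
  with AE_space show ?thesis
  proof eventually_elim
    case (elim x)
    then obtain N :: nat where N: "max_orbit_sum g n x \<le> real N" for n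
      unfolding unbounded_set_def by (auto simp: not_less)
    have "(\<Sum>i<n. g ((T ^^ i) x)) \<le> real N" for n
      using orbit_sum_le_max_orbit_sum[of g x] N by (cases n) (auto intro: order_trans)
    then show ?case by blast
  qed
qed

section \<open>Convergence of the averages\<close>

lemma finite_measure_subalgebra_invariant:
  "finite_measure_subalgebra M (invariant_algebra M T)"
  by (simp add: finite_measure_subalgebra_def finite_measure_axioms
      finite_measure_subalgebra_axioms_def subalgebra_invariant_algebra)

theorem birkhoff_pointwise:
  assumes f: "integrable M f"
  shows "AE x in M. (\<lambda>n. ergodic_average T f n x) \<longlonglongrightarrow> real_cond_exp M (invariant_algebra M T) f x"
proof -
  interpret sub: finite_measure_subalgebra M "invariant_algebra M T"
    by (rule finite_measure_subalgebra_invariant)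
  define h where "h = real_cond_exp M (invariant_algebra M T) f"
  have h_meas: "h \<in> borel_measurable (invariant_algebra M T)"
    unfolding h_def by simp
  have h: "integrable M h"
    unfolding h_def by (rule sub.real_cond_exp_int(1)[OF f])
  have intA: "integrable M (\<lambda>x. indicator A x * u x)"
    if "A \<in> sets (invariant_algebra M T)" "integrable M u" for A and u :: "'a \<Rightarrow> real"
    using integrable_mult_indicator[of A M u] that by (simp add: sets_invariant_algebra)
  have int_eq: "(\<integral>x. indicator A x * f x \<partial>M) = (\<integral>x. indicator A x * h x \<partial>M)"
    if "A \<in> sets (invariant_algebra M T)" for A
    using sub.real_cond_exp_intA[OF f that] by (simp add: h_def set_lebesgue_integral_def)
  \<comment> \<open>The sign \<open>s\<close> treats the upper and the lower bound for the averages together.\<close>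
  have one_sided: "AE x in M. \<exists>N::nat. \<forall>n. s * ((\<Sum>i<n. f ((T ^^ i) x)) - n * h x) - n * \<epsilon> \<le> real N"
    if "\<epsilon> > 0" for s \<epsilon> :: real
  proof -
    define g where "g x = s * (f x - h x) - \<epsilon>" for x
    have "integrable M g" unfolding g_def using f h by simp
    moreover have "(\<integral>x. indicator A x * g x \<partial>M) = - \<epsilon> * measure M A"
      if A: "A \<in> sets (invariant_algebra M T)" for A
    proof -
      have AM: "A \<in> sets M" using A by (simp add: sets_invariant_algebra)
      have c: "integrable M (\<lambda>x. indicator A x * \<epsilon>)"
        by (rule intA[OF A]) simp
      have "(\<integral>x. indicator A x * g x \<partial>M)
          = (\<integral>x. s * (indicator A x * f x - indicator A x * h x) - indicator A x * \<epsilon> \<partial>M)"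
        by (simp add: g_def algebra_simps)
      also have "\<dots> = s * ((\<integral>x. indicator A x * f x \<partial>M) - (\<integral>x. indicator A x * h x \<partial>M))
          - (\<integral>x. indicator A x * \<epsilon> \<partial>M)"
        using intA[OF A f] intA[OF A h] c by simp
      also have "\<dots> = - \<epsilon> * measure M A"
        using AM by (simp add: int_eq[OF A])
      finally show ?thesis .
    qed
    ultimately have "AE x in M. \<exists>N::nat. \<forall>n. (\<Sum>i<n. g ((T ^^ i) x)) \<le> real N"
      using that by (intro AE_orbit_sums_bounded_above) auto
    moreover have "AE x in M. \<forall>n. (\<Sum>i<n. g ((T ^^ i) x))
        = s * ((\<Sum>i<n. f ((T ^^ i) x)) - n * h x) - n * \<epsilon>"
      by (intro AE_I2 allI)
         (simp add: g_def invariant_measurable_iterate[OF h_meas] sum_subtractf flip: sum_distrib_left)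
    ultimately show ?thesis by eventually_elim simp
  qed
  define e where "e k = 1 / real (Suc k)" for k
  have e_pos: "e k > 0" for k by (simp add: e_def)
  have "AE x in M. \<forall>k.
      (\<exists>N::nat. \<forall>n. 1 * ((\<Sum>i<n. f ((T ^^ i) x)) - n * h x) - n * e k \<le> real N) \<and>
      (\<exists>N::nat. \<forall>n. (-1) * ((\<Sum>i<n. f ((T ^^ i) x)) - n * h x) - n * e k \<le> real N)"
    unfolding AE_all_countable by (intro allI AE_conjI one_sided e_pos)
  then show ?thesis
    unfolding h_def[symmetric]
  proof eventually_elim
    case (elim x)
    show ?case
    proof (rule LIMSEQ_I)
      fix r :: real assume "0 < r"
      then obtain k where "e k < r / 2" unfolding e_def by (metis half_gt_zero nat_approx_posE)
      obtain N1 N2 :: nat where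
        N1: "\<And>n. 1 * ((\<Sum>i<n. f ((T ^^ i) x)) - n * h x) - n * e k \<le> real N1" and
        N2: "\<And>n. (-1) * ((\<Sum>i<n. f ((T ^^ i) x)) - n * h x) - n * e k \<le> real N2"
        using elim by blast
      \<comment> \<open>From here on the bound on the orbit sums contributes less than \<open>r / 2\<close> to the averages.\<close>
      obtain n0 :: nat where n0: "real (N1 + N2) / (r / 2) < real n0" using reals_Archimedean2 by blast
      have "norm (ergodic_average T f n x - h x) < r" if "n \<ge> Suc n0" for n
      proof -
        have n: "real n > 0" using that by simp
        have "real (N1 + N2) < real n0 * (r / 2)"
          using n0 \<open>0 < r\<close> by (simp add: field_simps)
        also have "\<dots> \<le> real n * (r / 2)"
          using that \<open>0 < r\<close> by (intro mult_right_mono) auto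
        finally have a: "real N1 + real N2 < real n * (r / 2)" by simp
        have b: "real n * e k < real n * (r / 2)"
          using \<open>e k < r / 2\<close> n by simp
        have "\<bar>(\<Sum>i<n. f ((T ^^ i) x)) - n * h x\<bar> < real n * (r / 2) + real n * (r / 2)"
          using N1[of n] N2[of n] a b unfolding abs_less_iff mult_minus1 mult_1 by linarith
        also have "\<dots> = real n * r" by simp
        finally have d: "\<bar>(\<Sum>i<n. f ((T ^^ i) x)) - n * h x\<bar> < real n * r" .
        have "ergodic_average T f n x - h x = ((\<Sum>i<n. f ((T ^^ i) x)) - n * h x) / n"
          using n by (simp add: ergodic_average_def field_simps)
        then have "norm (ergodic_average T f n x - h x) = \<bar>(\<Sum>i<n. f ((T ^^ i) x)) - n * h x\<bar> / n"
          by simp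
        also have "\<dots> < r"
          using d n by (simp add: pos_divide_less_eq mult.commute)
        finally show ?thesis .
      qed
      then show "\<exists>no. \<forall>n\<ge>no. norm (ergodic_average T f n x - h x) < r" by blast
    qed
  qed
qed

end

theorem theorem5:
  fixes M :: "'a measure" and T :: "'a \<Rightarrow> 'a" and f :: "'a \<Rightarrow> real"
  assumes "standard_prob_space M"
    and "mp_automorphism M T"
    and "integrable M f"
  shows "(AE x in M. convergent (\<lambda>n. ergodic_average T f n x)) \<and>
         (AE x in M. lim (\<lambda>n. ergodic_average T f n x) =
                     real_cond_exp M (invariant_algebra M T) f x)"
proof -
  interpret prob_space M
    using assms(1) by (simp add: standard_prob_space_def)
  interpret finite_measure_preserving M T
    using assms(2) by unfold_locales (auto simp: mp_automorphism_def)
  have lim: "AE x in M. (\<lambda>n. ergodic_average T f n x) \<longlonglongrightarrow> real_cond_exp M (invariant_algebra M T) f x"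
    by (rule birkhoff_pointwise[OF assms(3)])
  from lim have "AE x in M. convergent (\<lambda>n. ergodic_average T f n x)"
    by eventually_elim (rule convergentI)
  moreover from lim have "AE x in M. lim (\<lambda>n. ergodic_average T f n x) =
      real_cond_exp M (invariant_algebra M T) f x"
    by eventually_elim (rule limI)
  ultimately show ?thesis ..
qed

end
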